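(* Let $\mathcal{T}$ denote the set of twin primes exceeding $3$, that is, the set of all primes $p>3$ for which $p-2$ or $p+2$ is also prime. Then $\mathcal{T}$ is Erdős-best among primitive subsets of $\mathbb{N}(\mathcal{T})$; that is, for every primitive set $\mathcal{S}\subset\mathbb{N}(\mathcal{T})$, $$\sum_{n\in\mathcal{S}}\frac{1}{n\log n}\le\sum_{p\in\mathcal{T}}\frac{1}{p\log p}.$$
   Context: $\mathbb{N}=\{1,2,3,\dots\}$. For a set $\mathcal{P}$ of primes, $\mathbb{N}(\mathcal{P})$ is the set of natural numbers all of whose prime factors lie in $\mathcal{P}$. A nonempty set of natural numbers is called primitive if no element of the set divides another (distinct) element; by convention the singleton $\{1\}$ is not primitive (hence no primitive set contains $1$). Sums of nonnegative terms over possibly infinite sets are taken in $[0,\infty]$. *)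

theory Defs
  imports "HOL-Analysis.Analysis" "HOL-Computational_Algebra.Primes"
begin

text \<open>Natural numbers are positive throughout, so \<open>0\<close> is excluded explicitly.\<close>

definition nat_over :: "nat set \<Rightarrow> nat set" where
  "nat_over P = {n. n > 0 \<and> (\<forall>p. prime p \<and> p dvd n \<longrightarrow> p \<in> P)}"

text \<open>The singleton \<open>{1}\<close> is by convention not primitive. Any other set containing \<open>1\<close>
  already fails the divisibility condition.\<close>

definition primitive_set :: "nat set \<Rightarrow> bool" where
  "primitive_set S \<longleftrightarrow> S \<noteq> {} \<and> S \<noteq> {1} \<and> 0 \<notin> S \<and>
     (\<forall>m\<in>S. \<forall>n\<in>S. m \<noteq> n \<longrightarrow> \<not> m dvd n)"

text \<open>The sum lives in \<^typ>\<open>ennreal\<close>, where every family is summable, so a divergent sum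
  has the value \<open>\<infinity>\<close>.\<close>

definition erdos_sum :: "nat set \<Rightarrow> ennreal" where
  "erdos_sum S = (\<Sum>\<^sub>\<infinity>n\<in>S. ennreal (1 / (real n * ln (real n))))"

definition erdos_best :: "nat set \<Rightarrow> bool" where
  "erdos_best P \<longleftrightarrow>
     (\<forall>S. S \<subseteq> nat_over P \<and> primitive_set S \<longrightarrow> erdos_sum S \<le> erdos_sum P)"

text \<open>Truncated subtraction is harmless here because \<open>p > 3\<close>.\<close>

definition twin_primes_gt3 :: "nat set" where
  "twin_primes_gt3 = {p. prime p \<and> p > 3 \<and> (prime (p - 2) \<or> prime (p + 2))}"

end

theory Submission
  imports Defs "HOL-Number_Theory.Prime_Powers"
begin

text \<open>Write \<open>w n = 1 / (n * ln n)\<close>. The proof works for every set \<open>Q\<close> of primes exceeding \<open>3\<close>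
  and rests on a Markov chain that descends along divisibility. From a number \<open>m > 1\<close> composed of
  primes of \<open>Q\<close>, the chain moves to \<open>m div q\<close> with probability \<open>mangoldt q / ln m\<close>; these
  probabilities add up to \<open>1\<close> because \<open>(\<Sum>q | q dvd m. mangoldt q) = ln m\<close>. Only powers of a
  single prime are treated differently: \<open>p ^ k\<close> moves to \<open>p\<close> at once, and the primes are absorbing.
  So every path ends in \<open>Q\<close>.

  The point is that \<open>w\<close> is superharmonic: the total flow of \<open>w\<close> into any \<open>n\<close> is at most
  \<open>w n\<close> (lemma \<open>erdos_weight_superharmonic\<close>). Indeed, if \<open>mangoldt\<close> is replaced by its mean
  value \<open>1\<close>, the flow into \<open>n\<close> from the multiples \<open>n * q\<close> becomes
  \<open>1 / n\<close> times the integral of \<open>1 / (ln n + t)\<^sup>2\<close> over \<open>t = ln q \<ge> 0\<close>, which is exactly \<open>w n\<close>.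
  Since the prime factors \<open>2\<close> and \<open>3\<close> do not occur, an elementary form of Mertens' theorem
  (\<open>mertens_coprime6_le\<close>) gives the actual inequality, with enough slack to absorb the additional flow
  from the powers of a prime to that prime.

  Given a finite primitive set \<open>A\<close>, release the mass \<open>w a\<close> at each \<open>a \<in> A\<close> and let it follow the chain.
  A path that starts in \<open>A\<close> never meets \<open>A\<close> again, so superharmonicity shows, going from large
  numbers to small ones, that the mass passing through any \<open>n\<close> never exceeds \<open>w n\<close>. In the end all
  mass sits on primes of \<open>Q\<close>, at most \<open>w p\<close> on each prime \<open>p\<close>. Hence the sum of \<open>w\<close> over \<open>A\<close> is at
  most the sum over \<open>Q\<close> (lemma \<open>sum_antichain_le\<close>).\<close>

section \<open>Chebyshev and Stirling bounds\<close>

text \<open>Legendre's formula in logarithmic form, obtained by summing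
  \<open>ln m = (\<Sum>d | d dvd m. mangoldt d)\<close> over \<open>m \<le> n\<close>. The upper limit \<open>N\<close> of the sum is
  left free so that factorials of different numbers can be compared term by term.\<close>

lemma ln_fact_eq_sum_mangoldt:
  assumes "n \<le> N"
  shows "ln (fact n) = (\<Sum>d = 1..N. mangoldt d * real (n div d))"
  using assms
proof (induction n)
  case 0
  then show ?case by simp
next
  case (Suc n)
  have "ln (fact (Suc n) :: real) = ln (real (Suc n)) + ln (fact n)"
    by (simp add: ln_mult)
  also have "ln (real (Suc n)) = (\<Sum>d | d dvd Suc n. mangoldt d)"
    using mangoldt_sum[of "Suc n", where ?'a = real] by simp
  also have "\<dots> = (\<Sum>d = 1..N. if d dvd Suc n then mangoldt d else 0)"
  proof (intro sum.mono_neutral_cong_left ballI)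
    show "{d. d dvd Suc n} \<subseteq> {1..N}"
    proof
      fix d assume "d \<in> {d. d dvd Suc n}"
      hence "d dvd Suc n" by simp
      with dvd_imp_le[OF this] dvd_pos_nat[OF _ this] Suc.prems show "d \<in> {1..N}" by simp
    qed
  qed auto
  also have "ln (fact n) = (\<Sum>d = 1..N. mangoldt d * real (n div d))"
    using Suc by simp
  also have "(\<Sum>d = 1..N. if d dvd Suc n then mangoldt d else 0) + \<dots> =
      (\<Sum>d = 1..N. mangoldt d * real (Suc n div d))"
    unfolding sum.distrib [symmetric]
    by (intro sum.cong) (auto simp: div_Suc algebra_simps mod_eq_0_iff_dvd)
  finally show ?case .
qed

text \<open>By Legendre's formula \<open>ln ((a + b) choose a)\<close> is a combination of values \<open>mangoldt d\<close> with the
  coefficients \<open>(a + b) div d - a div d - b div d\<close>. These are nonnegative, and they equal \<open>1\<close> for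
  \<open>b < d \<le> a + b\<close>, because then \<open>d\<close> exceeds both summands.\<close>

lemma sum_mangoldt_le_ln_binomial:
  assumes "a \<le> b"
  shows "(\<Sum>d = 1..a + b. mangoldt d) \<le>
           (\<Sum>d = 1..b. mangoldt d) + ln (real ((a + b) choose a))"
proof -
  let ?n = "a + b"
  have "fact a * fact b * (?n choose a) = fact ?n"
    using binomial_fact_lemma[of a ?n] by simp
  from arg_cong[OF this, of real] have "fact a * fact b * real (?n choose a) = fact ?n"
    by simp
  hence "ln (fact ?n :: real) = ln (fact a * fact b * real (?n choose a))"
    by simp
  also have "\<dots> = ln (fact a) + ln (fact b) + ln (real (?n choose a))"
    by (simp add: ln_mult)
  finally have *: "ln (real (?n choose a)) = ln (fact ?n) - ln (fact a) - ln (fact b)"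
    by simp
  have "(\<Sum>d = 1..?n. mangoldt d) - (\<Sum>d = 1..b. mangoldt d) =
      (\<Sum>d = 1..?n. if d > b then mangoldt d else 0 :: real)"
  proof -
    have "(\<Sum>d = 1..b. mangoldt d) = (\<Sum>d = 1..?n. if d > b then 0 else mangoldt d :: real)"
      by (intro sum.mono_neutral_cong_left) auto
    thus ?thesis
      by (auto simp: sum_subtractf [symmetric] intro!: sum.cong)
  qed
  also have "\<dots> \<le> (\<Sum>d = 1..?n. mangoldt d * (real (?n div d) - real (a div d) - real (b div d)))"
  proof (intro sum_mono)
    fix d assume d: "d \<in> {1..?n}"
    show "(if d > b then mangoldt d else 0 :: real) \<le>
        mangoldt d * (real (?n div d) - real (a div d) - real (b div d))"
    proof (cases "d > b")
      case True
      hence "a div d = 0" "b div d = 0" "?n div d \<ge> 1"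
        using assms d by (auto simp: Suc_le_eq div_greater_zero_iff)
      thus ?thesis
        using True mangoldt_nonneg[of d] mult_left_mono[of 1 "real (?n div d)" "mangoldt d"] by simp
    next
      case False
      have "a div d + b div d \<le> ?n div d"
        by (subst div_add1_eq) simp
      hence "real (a div d) + real (b div d) \<le> real (?n div d)"
        by (metis of_nat_add of_nat_le_iff)
      thus ?thesis using False mangoldt_nonneg[of d] by simp
    qed
  qed
  also have "\<dots> = ln (real (?n choose a))"
    unfolding * ln_fact_eq_sum_mangoldt[of ?n ?n, OF order.refl]
      ln_fact_eq_sum_mangoldt[of a ?n, OF le_add1] ln_fact_eq_sum_mangoldt[of b ?n, OF le_add2]
    by (simp add: sum_subtractf [symmetric] algebra_simps)
  finally show ?thesis by simp
qed

lemma odd_middle_binomial_le: "(2 * m + 1) choose m \<le> 4 ^ m"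
proof -
  have "2 * ((2 * m + 1) choose m) = (\<Sum>k\<in>{m, Suc m}. (2 * m + 1) choose k)"
    using binomial_symmetric[of m "2 * m + 1"] by simp
  also have "\<dots> \<le> (\<Sum>k\<le>2 * m + 1. (2 * m + 1) choose k)"
    by (intro sum_mono2) auto
  also have "\<dots> = 2 * 4 ^ m"
    by (simp only: choose_row_sum) (simp add: power_mult)
  finally show ?thesis by simp
qed

lemma even_middle_binomial_le: "(2 * m) choose m \<le> 4 ^ m"
proof -
  have "(2 * m) choose m \<le> (\<Sum>k\<le>2 * m. (2 * m) choose k)"
    by (intro member_le_sum) auto
  thus ?thesis by (simp add: choose_row_sum power_mult)
qed

text \<open>Chebyshev's bound. Halving \<open>n\<close> costs at most the logarithm of a middle binomial coefficient,
  which is at most \<open>\<lfloor>n / 2\<rfloor> * ln 4\<close>; strong induction adds these costs up.\<close>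

lemma chebyshev_psi_le: "(\<Sum>d = 1..n. mangoldt d) \<le> real n * ln 4"
proof (induction n rule: less_induct)
  case (less n)
  have binom_ln: "ln (real c) \<le> real m * ln 4" if "c \<le> 4 ^ m" "c > 0" for c m
  proof -
    have "ln (real c) \<le> ln (real (4 ^ m))"
      using that by (subst ln_le_cancel_iff) (auto simp del: of_nat_power)
    thus ?thesis by (simp add: ln_realpow)
  qed
  have "n \<le> 1 \<or> (\<exists>m\<ge>1. n = 2 * m) \<or> (\<exists>m\<ge>1. n = 2 * m + 1)"
    by presburger
  then consider "n \<le> 1" | m where "n = 2 * m" "m \<ge> 1" | m where "n = 2 * m + 1" "m \<ge> 1"
    by blast
  thus ?case
  proof cases
    case 1
    hence "n = 0 \<or> n = 1" by auto
    thus ?thesis by auto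
  next
    case (2 m)
    have "(\<Sum>d = 1..m + m. mangoldt d) \<le> (\<Sum>d = 1..m. mangoldt d) + ln (real ((m + m) choose m))"
      by (rule sum_mangoldt_le_ln_binomial) simp
    moreover have "(\<Sum>d = 1..m. mangoldt d) \<le> real m * ln 4"
      using 2 by (intro less.IH) auto
    moreover have "ln (real ((2 * m) choose m)) \<le> real m * ln 4"
      using even_middle_binomial_le[of m] by (intro binom_ln) auto
    ultimately have "(\<Sum>d = 1..2 * m. mangoldt d) \<le> real m * ln 4 + real m * ln 4"
      unfolding mult_2 [symmetric] by linarith
    thus ?thesis using 2 by (simp add: algebra_simps)
  next
    case (3 m)
    have sum_eq: "m + Suc m = 2 * m + 1" by simp
    have "(\<Sum>d = 1..m + Suc m. mangoldt d) \<le>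
        (\<Sum>d = 1..Suc m. mangoldt d) + ln (real ((m + Suc m) choose m))"
      by (rule sum_mangoldt_le_ln_binomial) simp
    moreover have "(\<Sum>d = 1..Suc m. mangoldt d) \<le> real (Suc m) * ln 4"
      using 3 by (intro less.IH) auto
    moreover have "ln (real ((2 * m + 1) choose m)) \<le> real m * ln 4"
      using odd_middle_binomial_le[of m] by (intro binom_ln) auto
    ultimately have "(\<Sum>d = 1..2 * m + 1. mangoldt d) \<le> real (Suc m) * ln 4 + real m * ln 4"
      unfolding sum_eq by linarith
    thus ?thesis using 3 by (simp add: algebra_simps)
  qed
qed

text \<open>A weak Stirling bound, by induction: the step amounts to
  \<open>ln (1 + 1 / n) \<ge> 1 / (n + 1)\<close>.\<close>

lemma ln_fact_le:
  assumes "n \<ge> 1"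
  shows "ln (fact n) \<le> real n * ln n - n + 1 + ln n"
  using assms
proof (induction n rule: nat_induct_at_least)
  case base
  then show ?case by simp
next
  case (Suc n)
  have "ln (real n / real (Suc n)) \<le> real n / real (Suc n) - 1"
    using Suc.hyps by (intro ln_le_minus_one) auto
  hence "ln (real n) - ln (real (Suc n)) \<le> - 1 / real (Suc n)"
    using Suc.hyps by (simp add: ln_div field_simps)
  hence "real (Suc n) * (ln (real n) - ln (real (Suc n))) \<le> real (Suc n) * (- 1 / real (Suc n))"
    by (intro mult_left_mono) auto
  hence *: "real (Suc n) * (ln (real n) - ln (real (Suc n))) \<le> - 1"
    by simp
  have "ln (fact (Suc n) :: real) = ln (real (Suc n)) + ln (fact n)"
    by (simp add: ln_mult)
  with Suc.IH * show ?case by (simp add: algebra_simps)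
qed

section \<open>Mertens sums over integers coprime to 6\<close>

definition mangoldt_coprime6 :: "nat \<Rightarrow> real" where
  "mangoldt_coprime6 d = (if coprime d 6 then mangoldt d else 0)"

lemma mangoldt_coprime6_nonneg: "mangoldt_coprime6 d \<ge> 0"
  by (simp add: mangoldt_coprime6_def mangoldt_nonneg)

lemma sum_mangoldt_coprime6_small:
  assumes "N < 5"
  shows "(\<Sum>d = 1..N. mangoldt_coprime6 d / d * f d) = 0"
proof (intro sum.neutral ballI)
  fix d assume "d \<in> {1..N}"
  hence "d = 1 \<or> d = 2 \<or> d = 3 \<or> d = 4" using assms by auto
  moreover have "\<not> coprime (2 :: nat) 6" "\<not> coprime (3 :: nat) 6" "\<not> coprime (4 :: nat) 6"
    by (rule not_coprimeI[of 2], simp_all) (rule not_coprimeI[of 3], simp_all, rule not_coprimeI[of 2], simp_all)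
  ultimately show "mangoldt_coprime6 d / d * f d = 0"
    by (auto simp: mangoldt_coprime6_def)
qed

text \<open>Mertens' first theorem with an explicit constant. Replacing \<open>N / d\<close> by \<open>N div d\<close> in Legendre's
  formula for \<open>N!\<close> costs at most \<open>mangoldt d\<close> for each \<open>d\<close>, hence
  \<open>(\<Sum>d \<le> N. mangoldt d / d) \<le> ln N - 1 + ln 4 + (1 + ln N) / N\<close>
  by the bounds of Chebyshev and Stirling. For \<open>N \<ge> 6\<close> the excess over \<open>ln N\<close> is at most the contribution of
  the three prime powers \<open>2\<close>, \<open>3\<close>, \<open>4\<close>, which is missing in the sum over integers coprime to \<open>6\<close>; for \<open>N = 5\<close> only the term \<open>d = 5\<close> is left.\<close>

lemma mertens_coprime6_le:
  assumes "N \<ge> 5"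
  shows "(\<Sum>d = 1..N. mangoldt_coprime6 d / d) \<le> ln N"
proof (cases "N = 5")
  case True
  have "(\<Sum>d = 1..N. mangoldt_coprime6 d / d) = (\<Sum>d = 1..Suc 4. mangoldt_coprime6 d / d)"
    using True by simp
  also have "\<dots> = mangoldt_coprime6 5 / 5"
    using sum_mangoldt_coprime6_small[of 4 "\<lambda>_. 1"] by (subst sum.cl_ivl_Suc) simp
  also have "\<dots> \<le> ln 5 / 5"
    using mangoldt_le[of 5] by (auto simp: mangoldt_coprime6_def)
  also have "\<dots> \<le> ln 5" by simp
  finally show ?thesis using True by simp
next
  case False
  hence N: "N \<ge> 6" using assms by simp
  have not_cop: "\<not> coprime (2 :: nat) 6" "\<not> coprime (3 :: nat) 6" "\<not> coprime (4 :: nat) 6"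
    by (rule not_coprimeI[of 2], simp_all) (rule not_coprimeI[of 3], simp_all, rule not_coprimeI[of 2], simp_all)
  have m2: "mangoldt 2 = ln (2 :: real)" by simp
  have m3: "mangoldt 3 = ln (3 :: real)" by (subst mangoldt_prime) auto
  have m4: "mangoldt 4 = ln (2 :: real)" using mangoldt_primepow'[of 2 2, where ?'a = real] by simp

  have "(\<Sum>d = 1..N. mangoldt d / d) * N - (\<Sum>d = 1..N. mangoldt d) =
      (\<Sum>d = 1..N. mangoldt d * (N / d - 1))"
    unfolding sum_distrib_right sum_subtractf [symmetric]
    by (intro sum.cong refl) (simp add: algebra_simps)
  also have "\<dots> \<le> (\<Sum>d = 1..N. mangoldt d * real (N div d))"
  proof (intro sum_mono mult_left_mono)
    fix d :: nat
    show "real N / real d - 1 \<le> real (N div d)"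
      using floor_divide_of_nat_eq[of N d, where ?'a = real] by linarith
  qed (rule mangoldt_nonneg)
  also have "\<dots> = ln (fact N)" by (rule ln_fact_eq_sum_mangoldt [symmetric]) simp
  also have "\<dots> \<le> real N * ln N - N + 1 + ln N"
    using N by (intro ln_fact_le) auto
  finally have "(\<Sum>d = 1..N. mangoldt d / d) * N \<le> real N * ln N - N + 1 + ln N + N * ln 4"
    using chebyshev_psi_le[of N] by linarith
  hence all: "(\<Sum>d = 1..N. mangoldt d / d) \<le> ln N - 1 + (1 + ln N) / N + ln 4"
    using N by (simp add: field_simps)

  have "(\<Sum>d = 1..N. mangoldt_coprime6 d / d) + (\<Sum>d\<in>{2,3,4}. mangoldt d / d) =
      (\<Sum>d = 1..N. mangoldt_coprime6 d / d + (if d \<in> {2,3,4} then mangoldt d / d else 0))"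
  proof -
    have "(\<Sum>d\<in>{2,3,4}. mangoldt d / d) = (\<Sum>d = 1..N. if d \<in> {2,3,4} then mangoldt d / d else 0 :: real)"
      using N by (intro sum.mono_neutral_cong_left) auto
    thus ?thesis by (simp only: sum.distrib)
  qed
  also have "\<dots> \<le> (\<Sum>d = 1..N. mangoldt d / d)"
    using not_cop by (intro sum_mono) (auto simp: mangoldt_coprime6_def mangoldt_nonneg)
  finally have split: "(\<Sum>d = 1..N. mangoldt_coprime6 d / d) \<le>
      (\<Sum>d = 1..N. mangoldt d / d) - 3 / 4 * ln 2 - ln 3 / 3"
    by (simp add: m2 m3 m4)

  \<comment> \<open>With \<open>ln 3 \<ge> 3/2 * ln 2\<close> and \<open>ln N \<le> N / 8 - 1 + ln 8\<close> (tangent at \<open>8\<close>) everything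
    reduces to \<open>5/4 * ln 2 \<le> 7/8\<close>.\<close>
  have ln2: "ln 2 \<le> (25 / 36 :: real)" by (rule ln2_le_25_over_36)
  have ln4: "ln (4 :: real) = 2 * ln 2" using ln_realpow[of 2 2] by simp
  have ln8: "ln (8 :: real) = 3 * ln 2" using ln_realpow[of 2 3] by simp
  have ln9: "ln (9 :: real) = 2 * ln 3" using ln_realpow[of 3 2] by simp
  have ln3: "ln (3 :: real) \<ge> 3 / 2 * ln 2"
  proof -
    have "ln (8 :: real) \<le> ln 9" by simp
    thus ?thesis using ln8 ln9 by simp
  qed
  have "ln (real N / 8) \<le> real N / 8 - 1"
    using N by (intro ln_le_minus_one) auto
  hence "ln N \<le> N / 8 - 1 + 3 * ln 2"
    using N ln8 by (simp add: ln_div)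
  hence "(1 + ln N) / N \<le> (N / 8 + 3 * ln 2) / N"
    by (intro divide_right_mono) auto
  also have "\<dots> = 1 / 8 + 3 * ln 2 / N"
    using N by (simp add: field_simps)
  also have "3 * ln 2 / N \<le> 3 * ln 2 / 6"
    using N by (intro divide_left_mono) auto
  finally have "(1 + ln N) / N \<le> 1 / 8 + ln 2 / 2" by simp
  with all split ln2 ln3 ln4 show ?thesis by argo
qed

text \<open>Abel summation against the Mertens bound. If the partial sums of \<open>mangoldt_coprime6 q / q\<close> were
  exactly \<open>0\<close> below \<open>5\<close> and \<open>ln M\<close> from \<open>5\<close> on, the sum would be a mass \<open>ln 5\<close> placed at
  \<open>q = 5\<close> plus at most the integral of \<open>1 / (x + t)\<^sup>2\<close> over \<open>t \<ge> ln 5\<close>, that is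
  \<open>ln 5 / (x + ln 5)\<^sup>2 + 1 / (x + ln 5)\<close>.
  Compared with \<open>1 / x\<close>, the corresponding integral over all \<open>t \<ge> 0\<close>, this leaves the slack
  \<open>(ln 5)\<^sup>2 / (x * (x + ln 5)\<^sup>2)\<close>.\<close>

lemma sum_mangoldt_coprime6_kernel_le:
  fixes x :: real
  assumes "x > 0"
  shows "(\<Sum>q = 1..M. mangoldt_coprime6 q / q * (1 / (x + ln q)\<^sup>2)) \<le> (x + 2 * ln 5) / (x + ln 5)\<^sup>2"
proof (cases "M < 5")
  case True
  have "(\<Sum>q = 1..M. mangoldt_coprime6 q / q * (1 / (x + ln q)\<^sup>2)) = 0"
    using sum_mangoldt_coprime6_small[OF True] .
  also have "0 \<le> (x + 2 * ln 5) / (x + ln 5)\<^sup>2" using assms by simp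
  finally show ?thesis .
next
  case False
  define \<phi> where "\<phi> = (\<lambda>q :: nat. 1 / (x + ln q)\<^sup>2)"
  define S where "S = (\<lambda>N. \<Sum>d = 1..N. mangoldt_coprime6 d / d)"
  have S_Suc: "S (Suc N) = S N + mangoldt_coprime6 (Suc N) / Suc N" for N
    by (simp add: S_def)
  have pos: "x + ln (real k) > 0" if "k \<ge> 1" for k :: nat
    using that assms by (intro add_pos_nonneg) auto
  have "M \<ge> 5" using False by simp
  \<comment> \<open>Carrying the boundary term \<open>(ln M - S M) * \<phi> M\<close> along turns the summation by parts into an
    induction on \<open>M\<close>.\<close>
  hence "(\<Sum>q = 1..M. mangoldt_coprime6 q / q * \<phi> q) + (ln M - S M) * \<phi> M \<le>
      ln 5 * \<phi> 5 + 1 / (x + ln 5) - 1 / (x + ln M)"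
  proof (induction M rule: nat_induct_at_least)
    case base
    have "(\<Sum>q = 1..5. mangoldt_coprime6 q / q * \<phi> q) = mangoldt_coprime6 5 / 5 * \<phi> 5"
      using sum_mangoldt_coprime6_small[of 4 \<phi>] sum.cl_ivl_Suc[of "\<lambda>q. mangoldt_coprime6 q / q * \<phi> q" 1 4]
      by simp
    moreover have "S 5 = mangoldt_coprime6 5 / 5"
      using sum_mangoldt_coprime6_small[of 4 "\<lambda>_. 1"] S_Suc[of 4] by (simp add: S_def)
    ultimately have "(\<Sum>q = 1..5. mangoldt_coprime6 q / q * \<phi> q) = S 5 * \<phi> 5" by (simp only:)
    thus ?case by (simp add: algebra_simps)
  next
    case (Suc M)
    let ?a = "x + ln (real M)" and ?b = "x + ln (real (Suc M))"
    have ab: "0 < ?a" "?a \<le> ?b" using Suc.hyps pos[of M] by auto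
    have "\<phi> (Suc M) \<le> \<phi> M"
      unfolding \<phi>_def using ab by (intro divide_left_mono power_mono mult_pos_pos) auto
    hence 1: "(ln M - S M) * (\<phi> (Suc M) - \<phi> M) \<le> 0"
      using mertens_coprime6_le[of M] Suc.hyps
      by (intro mult_nonneg_nonpos) (auto simp: S_def)
    have "(?b - ?a) * \<phi> (Suc M) = (?b - ?a) / (?b * ?b)"
      by (simp add: \<phi>_def power2_eq_square)
    also have "\<dots> \<le> (?b - ?a) / (?a * ?b)"
      using ab by (intro divide_left_mono mult_right_mono mult_pos_pos) auto
    also have "\<dots> = 1 / ?a - 1 / ?b"
      using ab by (simp add: field_simps)
    finally have 2: "(ln (Suc M) - ln M) * \<phi> (Suc M) \<le> 1 / ?a - 1 / ?b" by simp
    have "(\<Sum>q = 1..Suc M. mangoldt_coprime6 q / q * \<phi> q) + (ln (Suc M) - S (Suc M)) * \<phi> (Suc M) =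
      (\<Sum>q = 1..M. mangoldt_coprime6 q / q * \<phi> q) + (ln M - S M) * \<phi> M +
      (ln M - S M) * (\<phi> (Suc M) - \<phi> M) + (ln (Suc M) - ln M) * \<phi> (Suc M)"
      unfolding S_Suc by (simp add: algebra_simps)
    with Suc.IH 1 2 show ?case by linarith
  qed
  moreover have "(ln M - S M) * \<phi> M \<ge> 0"
    using mertens_coprime6_le[of M] False by (intro mult_nonneg_nonneg) (auto simp: S_def \<phi>_def)
  moreover have "1 / (x + ln M) \<ge> 0" using pos[of M] False by simp
  ultimately have "(\<Sum>q = 1..M. mangoldt_coprime6 q / q * \<phi> q) \<le> ln 5 * \<phi> 5 + 1 / (x + ln 5)"
    by linarith
  also have "\<dots> = (x + 2 * ln 5) / (x + ln 5)\<^sup>2"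
  proof -
    have "(x + 2 * ln 5) / (x + ln 5)\<^sup>2 = ln 5 / (x + ln 5)\<^sup>2 + (x + ln 5) / (x + ln 5)\<^sup>2"
      by (simp add: add_divide_distrib [symmetric])
    also have "(x + ln 5) / (x + ln 5)\<^sup>2 = 1 / (x + ln 5)"
      by (simp add: power2_eq_square)
    finally show ?thesis by (simp add: \<phi>_def)
  qed
  finally show ?thesis by (simp add: \<phi>_def)
qed

section \<open>Flows along divisor chains\<close>

text \<open>\<open>D m n\<close> is the probability of the step from \<open>m\<close> to \<open>n\<close> in a Markov chain that moves downwards.
  The sum ranges over \<open>m < a\<close> only, which makes the recursion well founded.\<close>

fun visit_prob :: "(nat \<Rightarrow> nat \<Rightarrow> real) \<Rightarrow> nat \<Rightarrow> nat \<Rightarrow> real" where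
  "visit_prob D a n = (if a = n then 1 else \<Sum>m<a. D a m * visit_prob D m n)"

declare visit_prob.simps [simp del]

locale divisor_chain =
  fixes D :: "nat \<Rightarrow> nat \<Rightarrow> real" and X P :: "nat set"
  assumes nonneg: "D m n \<ge> 0"
    and step: "m \<in> X \<Longrightarrow> D m n \<noteq> 0 \<Longrightarrow> n \<in> X \<and> n dvd m \<and> n < m"
    and total: "m \<in> X \<Longrightarrow> m \<notin> P \<Longrightarrow> (\<Sum>n<m. D m n) = 1"
    and absorbing: "p \<in> P \<Longrightarrow> D p n = 0"
begin

lemma visit_prob_nonneg: "visit_prob D a n \<ge> 0"
  by (induction a rule: less_induct) (subst visit_prob.simps, auto intro!: sum_nonneg simp: nonneg)

lemma visit_prob_eq_0: "a < n \<Longrightarrow> visit_prob D a n = 0"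
  by (induction a rule: less_induct) (subst visit_prob.simps, auto intro!: sum.neutral)

lemma visit_prob_imp_dvd: "a \<in> X \<Longrightarrow> visit_prob D a n \<noteq> 0 \<Longrightarrow> n dvd a"
proof (induction a rule: less_induct)
  case (less a)
  show ?case
  proof (cases "a = n")
    case False
    with less.prems have "(\<Sum>m<a. D a m * visit_prob D m n) \<noteq> 0"
      by (subst (asm) visit_prob.simps) auto
    then obtain m where m: "m < a" "D a m \<noteq> 0" "visit_prob D m n \<noteq> 0"
      by (auto elim!: sum.not_neutral_contains_not_neutral)
    with less.IH[of m] step[of a m] less.prems show ?thesis
      by (auto intro: dvd_trans)
  qed simp
qed

lemma visit_prob_first_step:
  "visit_prob D a n = of_bool (a = n) + (\<Sum>k<a. D a k * visit_prob D k n)"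
  by (subst visit_prob.simps) (auto intro!: sum.neutral simp: visit_prob_eq_0)

text \<open>The recursion splits a path at its first step. The flow into \<open>n\<close> is read off from the last step
  instead; the two decompositions agree by induction on the starting point.\<close>

lemma visit_prob_last_step:
  assumes "a \<in> X" "a \<le> M"
  shows "visit_prob D a n = of_bool (a = n) + (\<Sum>m\<in>X \<inter> {..M}. visit_prob D a m * D m n)"
  using assms
proof (induction a rule: less_induct)
  case (less a)
  let ?Y = "X \<inter> {..M}"
  have "(\<Sum>m\<in>?Y. visit_prob D a m * D m n) =
      (\<Sum>m\<in>?Y. of_bool (a = m) * D m n) + (\<Sum>m\<in>?Y. \<Sum>k<a. D a k * visit_prob D k m * D m n)"
    by (subst visit_prob_first_step) (simp add: sum.distrib algebra_simps sum_distrib_left)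
  also have "(\<Sum>m\<in>?Y. of_bool (a = m) * D m n) = D a n"
  proof -
    have "(\<Sum>m\<in>?Y. of_bool (a = m) * D m n) = (\<Sum>m\<in>?Y. if a = m then D m n else 0)"
      by (intro sum.cong) auto
    thus ?thesis using less.prems by simp
  qed
  also have "(\<Sum>m\<in>?Y. \<Sum>k<a. D a k * visit_prob D k m * D m n) =
      (\<Sum>k<a. D a k * (\<Sum>m\<in>?Y. visit_prob D k m * D m n))"
    by (subst sum.swap) (simp add: sum_distrib_left mult.assoc)
  also have "\<dots> = (\<Sum>k<a. D a k * visit_prob D k n - (if k = n then D a k else 0))"
  proof (intro sum.cong refl)
    fix k assume k: "k \<in> {..<a}"
    show "D a k * (\<Sum>m\<in>?Y. visit_prob D k m * D m n) =
        D a k * visit_prob D k n - (if k = n then D a k else 0)"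
    proof (cases "D a k = 0")
      case False
      hence "k \<in> X" using step less.prems by blast
      hence "visit_prob D k n = of_bool (k = n) + (\<Sum>m\<in>?Y. visit_prob D k m * D m n)"
        using k less.prems by (intro less.IH) auto
      thus ?thesis by (simp add: algebra_simps)
    qed auto
  qed
  also have "\<dots> = (\<Sum>k<a. D a k * visit_prob D k n) - D a n"
    using step[of a n] less.prems by (auto simp: sum_subtractf)
  also have "D a n + \<dots> = visit_prob D a n - of_bool (a = n)"
    by (subst visit_prob_first_step) simp
  finally show ?case by simp
qed

lemma absorption_total:
  assumes "P \<subseteq> X" "a \<in> X" "a \<le> M"
  shows "(\<Sum>p\<in>P \<inter> {..M}. visit_prob D a p) = 1"
  using assms(2,3)
proof (induction a rule: less_induct)
  case (less a)
  show ?case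
  proof (cases "a \<in> P")
    case True
    have "(\<Sum>p\<in>P \<inter> {..M}. visit_prob D a p) = (\<Sum>p\<in>P \<inter> {..M}. if a = p then 1 else 0)"
      by (intro sum.cong refl, subst visit_prob.simps) (auto simp: absorbing[OF True])
    thus ?thesis using True less.prems by simp
  next
    case False
    have "(\<Sum>p\<in>P \<inter> {..M}. visit_prob D a p) = (\<Sum>p\<in>P \<inter> {..M}. \<Sum>m<a. D a m * visit_prob D m p)"
      using False by (intro sum.cong refl, subst visit_prob.simps) auto
    also have "\<dots> = (\<Sum>m<a. D a m * (\<Sum>p\<in>P \<inter> {..M}. visit_prob D m p))"
      by (subst sum.swap) (simp add: sum_distrib_left)
    also have "\<dots> = (\<Sum>m<a. D a m)"
    proof (intro sum.cong refl)
      fix m assume m: "m \<in> {..<a}"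
      show "D a m * (\<Sum>p\<in>P \<inter> {..M}. visit_prob D m p) = D a m"
        using less.IH[of m] step[of a m] m less.prems by (cases "D a m = 0") auto
    qed
    also have "\<dots> = 1" using total False less.prems by simp
    finally show ?thesis .
  qed
qed

text \<open>Start the chain with mass \<open>w a\<close> at each \<open>a \<in> A\<close>, and let \<open>V n\<close> be the total mass that visits \<open>n\<close>.
  All mass is eventually absorbed in \<open>P\<close>, so that \<open>sum w A\<close> is the sum of \<open>V\<close> over \<open>P\<close>, and it is
  enough that \<open>V \<le> w\<close>. This holds on \<open>A\<close>, since no mass that starts elsewhere in an antichain
  comes through a point of \<open>A\<close>; at any other \<open>n\<close>, the mass arrives from larger numbers, where the
  inequality holds by induction, and the superharmonicity of \<open>w\<close> transfers it to \<open>n\<close>.\<close>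

lemma sum_antichain_le:
  fixes w :: "nat \<Rightarrow> real"
  assumes "P \<subseteq> X"
    and superharmonic: "\<And>n. n \<in> X \<Longrightarrow> (\<Sum>m\<in>X \<inter> {..M}. w m * D m n) \<le> w n"
    and A: "A \<subseteq> X \<inter> {..M}" "\<And>a b. a \<in> A \<Longrightarrow> b \<in> A \<Longrightarrow> a dvd b \<Longrightarrow> a = b"
  shows "sum w A \<le> sum w (P \<inter> {..M})"
proof -
  have "finite A" using A(1) finite_subset by blast
  define V where "V = (\<lambda>n. \<Sum>a\<in>A. w a * visit_prob D a n)"
  have V_le: "V n \<le> w n" if "n \<in> X" for n
    using that
  proof (induction "M - n" arbitrary: n rule: less_induct)
    case less
    show ?case
    proof (cases "n \<in> A")
      case True
      have "V n = (\<Sum>a\<in>A. if a = n then w n else 0)"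
        unfolding V_def
      proof (intro sum.cong refl)
        fix a assume a: "a \<in> A"
        show "w a * visit_prob D a n = (if a = n then w n else 0)"
          using visit_prob_imp_dvd[of a n] A a True by (auto simp: visit_prob.simps[of D n n])
      qed
      thus ?thesis using True \<open>finite A\<close> by simp
    next
      case False
      have "V n = (\<Sum>a\<in>A. w a * (\<Sum>m\<in>X \<inter> {..M}. visit_prob D a m * D m n))"
        unfolding V_def
      proof (intro sum.cong refl)
        fix a assume "a \<in> A"
        thus "w a * visit_prob D a n = w a * (\<Sum>m\<in>X \<inter> {..M}. visit_prob D a m * D m n)"
          using A False by (subst visit_prob_last_step[of a M n]) auto
      qed
      also have "\<dots> = (\<Sum>m\<in>X \<inter> {..M}. V m * D m n)"
        unfolding V_def sum_distrib_left sum_distrib_right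
        by (subst sum.swap) (simp add: mult_ac)
      also have "\<dots> \<le> (\<Sum>m\<in>X \<inter> {..M}. w m * D m n)"
      proof (intro sum_mono)
        fix m assume m: "m \<in> X \<inter> {..M}"
        show "V m * D m n \<le> w m * D m n"
        proof (cases "D m n = 0")
          case False
          hence "n < m" using step m by blast
          hence "V m \<le> w m" using m by (intro less.hyps) auto
          thus ?thesis by (intro mult_right_mono nonneg)
        qed simp
      qed
      also have "\<dots> \<le> w n" by (rule superharmonic) fact
      finally show ?thesis .
    qed
  qed
  have "sum w A = (\<Sum>a\<in>A. w a * (\<Sum>p\<in>P \<inter> {..M}. visit_prob D a p))"
  proof (intro sum.cong refl)
    fix a assume "a \<in> A"
    hence "(\<Sum>p\<in>P \<inter> {..M}. visit_prob D a p) = 1"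
      using A(1) by (intro absorption_total assms(1)) auto
    thus "w a = w a * (\<Sum>p\<in>P \<inter> {..M}. visit_prob D a p)" by simp
  qed
  also have "\<dots> = (\<Sum>p\<in>P \<inter> {..M}. V p)"
    unfolding V_def sum_distrib_left by (rule sum.swap)
  also have "\<dots> \<le> sum w (P \<inter> {..M})"
    using assms(1) by (intro sum_mono V_le) auto
  finally show ?thesis .
qed

end

section \<open>The von Mangoldt chain on integers without the prime factors 2 and 3\<close>

lemma nat_over_dvd: "m \<in> nat_over Q \<Longrightarrow> n dvd m \<Longrightarrow> n \<in> nat_over Q"
  by (auto simp: nat_over_def intro: dvd_trans Nat.gr0I)

lemma coprime6_if_nat_over:
  assumes "m \<in> nat_over Q" "\<And>q. q \<in> Q \<Longrightarrow> q > 3"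
  shows "coprime m 6"
proof (rule ccontr)
  assume "\<not> coprime m 6"
  then obtain p where p: "prime p" "p dvd m" "p dvd 6"
    using prime_factor_nat[of "gcd m 6"] by (auto simp: coprime_iff_gcd_eq_1)
  have "p dvd 2 * 3" using p by simp
  hence "p dvd 2 \<or> p dvd 3" using p prime_dvd_mult_iff by blast
  hence "p \<le> 3" by (auto dest: dvd_imp_le)
  moreover have "p \<in> Q" using assms(1) p by (auto simp: nat_over_def)
  ultimately show False using assms(2)[of p] by simp
qed

text \<open>A number that is not a prime power loses the factor \<open>q\<close> with probability
  \<open>mangoldt q / ln m\<close>; these probabilities add up to \<open>1\<close> because the sum of \<open>mangoldt\<close> over the
  divisors of \<open>m\<close> is \<open>ln m\<close>. For \<open>m = p ^ k\<close> this rule could lead to \<open>1\<close> and thus miss the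
  primes, so proper prime powers are sent directly to their prime, and primes are absorbing.\<close>

definition mangoldt_descent :: "nat \<Rightarrow> nat \<Rightarrow> real" where
  "mangoldt_descent m n =
     (if n dvd m then
        if primepow m then of_bool (\<not> prime m \<and> n = aprimedivisor m)
        else mangoldt (m div n) / ln m
      else 0)"

lemma divisor_chain_mangoldt_descent:
  assumes Q: "\<And>q. q \<in> Q \<Longrightarrow> prime q"
  shows "divisor_chain mangoldt_descent (nat_over Q - {1}) Q"
proof
  show "mangoldt_descent m n \<ge> 0" for m n
    by (cases "m = 0") (auto simp: mangoldt_descent_def mangoldt_nonneg)
next
  fix m n assume m: "m \<in> nat_over Q - {1}" and D: "mangoldt_descent m n \<noteq> 0"
  have "n dvd m" using D by (auto simp: mangoldt_descent_def split: if_splits)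
  moreover have "m > 1" using m by (auto simp: nat_over_def)
  moreover have "n \<noteq> m" "n \<noteq> 1"
    using D m prime_aprimedivisor'[of m] \<open>m > 1\<close>
    by (auto simp: mangoldt_descent_def mangoldt_def split: if_splits)
  moreover have "n \<le> m"
    using \<open>n dvd m\<close> \<open>m > 1\<close> by (intro dvd_imp_le) auto
  ultimately show "n \<in> nat_over Q - {1} \<and> n dvd m \<and> n < m"
    using m nat_over_dvd by auto
next
  fix m assume m: "m \<in> nat_over Q - {1}" "m \<notin> Q"
  hence "m > 1" by (auto simp: nat_over_def)
  have not_prime: "\<not> prime m" using m by (auto simp: nat_over_def)
  show "(\<Sum>n<m. mangoldt_descent m n) = 1"
  proof (cases "primepow m")
    case True
    let ?p = "aprimedivisor m"
    have p: "prime ?p" "?p dvd m"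
      using \<open>m > 1\<close> by (auto intro!: prime_aprimedivisor' aprimedivisor_dvd')
    hence "?p < m" using not_prime dvd_imp_le[of ?p m] \<open>m > 1\<close> by (metis le_neq_implies_less less_trans zero_less_one)
    have "(\<Sum>n<m. mangoldt_descent m n) = (\<Sum>n<m. if n = ?p then 1 else 0)"
      using True not_prime p by (intro sum.cong) (auto simp: mangoldt_descent_def)
    thus ?thesis using \<open>?p < m\<close> by simp
  next
    case False
    have "(\<Sum>n<m. mangoldt_descent m n) = (\<Sum>n | n dvd m. mangoldt (m div n) / ln m)"
    proof (intro sum.mono_neutral_cong)
      fix n assume "n \<in> {n. n dvd m} - {..<m}"
      hence "n = m" using dvd_imp_le[of n m] \<open>m > 1\<close> by auto
      thus "mangoldt (m div n) / ln (real m) = 0" using \<open>m > 1\<close> by simp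
    qed (use False \<open>m > 1\<close> in \<open>auto simp: mangoldt_descent_def\<close>)
    also have "\<dots> = (\<Sum>d | d dvd m. mangoldt d / ln m)"
      using \<open>m > 1\<close> by (intro sum.reindex_bij_witness[of _ "\<lambda>d. m div d" "\<lambda>d. m div d"]) (auto elim!: dvdE)
    also have "\<dots> = (\<Sum>d | d dvd m. mangoldt d) / ln m"
      by (simp add: sum_divide_distrib)
    also have "\<dots> = 1" using \<open>m > 1\<close> by (simp add: mangoldt_sum)
    finally show ?thesis .
  qed
next
  show "mangoldt_descent p n = 0" if "p \<in> Q" for p n
    using Q[OF that] by (auto simp: mangoldt_descent_def)
qed

text \<open>The second summand bounds the relative inflow into a prime \<open>p\<close> from its own powers. It has to fit
  into the slack \<open>u\<^sup>2 / (x * (x + u)\<^sup>2)\<close> with \<open>x = ln p\<close> and \<open>u = ln 5\<close>, which means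
  \<open>(x + u)\<^sup>2 \<le> 2 * u\<^sup>2 * (p - 1)\<close>. With \<open>x = u + d\<close> we have \<open>p = 5 * exp d\<close>, and the
  quadratic Taylor bound for \<open>exp d\<close> is already sufficient.\<close>

lemma primepow_inflow_slack:
  fixes p :: real
  assumes "p \<ge> 5"
  shows "(ln p + 2 * ln 5) / (ln p + ln 5)\<^sup>2 + 1 / (2 * ln p * (p - 1)) \<le> 1 / ln p"
proof -
  define x u d where "x = ln p" and "u = ln (5 :: real)" and "d = ln p - ln 5"
  have "exp 1 \<le> (5 :: real)" using exp_le by linarith
  hence u: "u \<ge> 1" using ln_ge_iff[of 5 1] by (simp add: u_def)
  have d: "d \<ge> 0" using assms by (simp add: d_def)
  have x: "x = u + d" by (simp add: x_def u_def d_def)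
  have "1 + d + d\<^sup>2 / 2 \<le> exp d"
    using d by (rule exp_lower_Taylor_quadratic)
  also have "exp d = p / 5"
    using assms by (simp add: d_def exp_diff)
  finally have p: "4 + 5 * d + 5 / 2 * d\<^sup>2 \<le> p - 1" by simp
  have "(x + u)\<^sup>2 = 4 * (u * u) + 4 * (u * d) + 1 * d\<^sup>2"
    by (simp add: x power2_eq_square algebra_simps)
  also have "\<dots> \<le> 8 * (u * u) + 10 * (u * (u * d)) + 5 * u\<^sup>2 * d\<^sup>2"
  proof (intro add_mono mult_right_mono)
    have "1 * (u * d) \<le> u * (u * d)" "0 \<le> u * d"
      using u d by (intro mult_right_mono mult_nonneg_nonneg; simp)+
    thus "4 * (u * d) \<le> 10 * (u * (u * d))" by linarith
    show "1 \<le> 5 * u\<^sup>2" using one_le_power[OF u, of 2] by linarith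
  qed (use u d in auto)
  also have "\<dots> = 2 * u\<^sup>2 * (4 + 5 * d + 5 / 2 * d\<^sup>2)"
    by (simp add: power2_eq_square algebra_simps)
  also have "\<dots> \<le> 2 * u\<^sup>2 * (p - 1)"
    using p by (intro mult_left_mono) auto
  finally have key: "(x + u)\<^sup>2 \<le> 2 * u\<^sup>2 * (p - 1)" .
  have pos: "x > 0" "x + u > 0" "p - 1 > 0" using u d assms by (auto simp: x)
  have "1 / (2 * x * (p - 1)) \<le> u\<^sup>2 / (x * (x + u)\<^sup>2)"
    using key pos by (simp add: divide_simps) (simp add: left_diff_distrib right_diff_distrib mult_ac)
  also have "\<dots> = 1 / x - (x + 2 * u) / (x + u)\<^sup>2"
    using pos by (simp add: divide_simps) (simp add: power2_eq_square algebra_simps)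
  finally show ?thesis by (simp add: x_def u_def)
qed

lemma geometric_tail_le:
  fixes r :: real
  assumes "0 \<le> r" "r < 1"
  shows "(\<Sum>k = 2..M. r ^ k) \<le> r\<^sup>2 / (1 - r)"
proof -
  have "(\<Sum>k = 2..M. r ^ k) * (1 - r) \<le> r\<^sup>2 - of_bool (M \<ge> 1) * r ^ Suc M"
  proof (induction M)
    case (Suc M)
    thus ?case
      by (cases "M = 0") (auto simp: algebra_simps power2_eq_square)
  qed simp
  also have "\<dots> \<le> r\<^sup>2" using assms by simp
  finally show ?thesis using assms by (simp add: pos_le_divide_eq)
qed

text \<open>The mass that flows into \<open>n\<close> has two sources. From \<open>m = n * q\<close> comes at most
  \<open>mangoldt q / (n * q * (ln n + ln q)\<^sup>2)\<close>, where \<open>q\<close> is coprime to \<open>6\<close>, and by Abel summation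
  these contributions stay below \<open>1 / (n * ln n)\<close> with some room to spare. If \<open>n\<close> is prime, the powers
  \<open>n ^ k\<close> send their whole weight to \<open>n\<close>; a geometric series shows that this fits into that room.\<close>

lemma erdos_weight_superharmonic:
  fixes Q :: "nat set"
  defines "X \<equiv> nat_over Q - {1}" and "w \<equiv> \<lambda>n :: nat. 1 / (real n * ln (real n))"
  assumes Q: "\<And>q. q \<in> Q \<Longrightarrow> prime q \<and> q > 3" and n: "n \<in> X"
  shows "(\<Sum>m\<in>X \<inter> {..M}. w m * mangoldt_descent m n) \<le> w n"
proof -
  have X1: "m > 1" if "m \<in> X" for m using that by (auto simp: X_def nat_over_def)
  have w_nonneg: "w m \<ge> 0" for m by (cases "m = 0") (auto simp: w_def)
  have "n > 1" using X1 n by simp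
  have "n \<ge> 5"
  proof -
    obtain p where p: "prime p" "p dvd n" using prime_factor_nat[of n] \<open>n > 1\<close> by auto
    have "p \<in> Q" using n p by (auto simp: X_def nat_over_def)
    hence "p > 3" using Q by blast
    moreover have "p \<noteq> 4" using p(1) prime_product[of 2 2] by auto
    moreover have "p \<le> n" using p \<open>n > 1\<close> by (intro dvd_imp_le) auto
    ultimately show ?thesis by simp
  qed
  define x where "x = ln (real n)"
  have "x > 0" using \<open>n > 1\<close> by (simp add: x_def)
  define Y where "Y = X \<inter> {..M}"
  have "finite Y" by (simp add: Y_def)
  define A where "A = {m \<in> Y. n dvd m}"
  define B where "B = {m \<in> Y. prime n \<and> (\<exists>k\<ge>2. m = n ^ k)}"

  \<comment> \<open>The inflow through \<open>A\<close> is counted for all multiples of \<open>n\<close>, prime powers included, so that the two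
    sources may overlap; an upper bound is all that is wanted.\<close>
  have "(\<Sum>m\<in>Y. w m * mangoldt_descent m n) \<le>
      (\<Sum>m\<in>Y. (if m \<in> A then w m * (mangoldt (m div n) / ln m) else 0) + (if m \<in> B then w m else 0))"
  proof (intro sum_mono)
    fix m assume m: "m \<in> Y"
    hence "m > 1" using X1 by (simp add: Y_def)
    have *: "w m * (mangoldt (m div n) / ln m) \<ge> 0"
      using \<open>m > 1\<close> by (intro mult_nonneg_nonneg w_nonneg divide_nonneg_nonneg mangoldt_nonneg) auto
    have "m \<in> B" if "primepow m" "\<not> prime m" "n = aprimedivisor m"
    proof -
      obtain p k where pk: "prime p" "k > 0" "m = p ^ k"
        using \<open>primepow m\<close> by (auto simp: primepow_def)
      have "n = p" using that pk by (simp add: aprimedivisor_prime_power)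
      moreover have "k \<noteq> 1" using pk that by auto
      ultimately show ?thesis using pk m by (auto simp: B_def intro!: exI[of _ k])
    qed
    thus "w m * mangoldt_descent m n \<le>
        (if m \<in> A then w m * (mangoldt (m div n) / ln m) else 0) + (if m \<in> B then w m else 0)"
      using * w_nonneg[of m] m by (auto simp: mangoldt_descent_def A_def)
  qed
  also have "\<dots> = (\<Sum>m\<in>A. w m * (mangoldt (m div n) / ln m)) + (\<Sum>m\<in>B. w m)"
  proof -
    have "Y \<inter> {m. m \<in> A} = A" "Y \<inter> {m. m \<in> B} = B" by (auto simp: A_def B_def)
    thus ?thesis using \<open>finite Y\<close> by (simp add: sum.distrib sum.If_cases)
  qed
  also have "(\<Sum>m\<in>A. w m * (mangoldt (m div n) / ln m)) \<le>
      (\<Sum>q = 1..M. 1 / n * (mangoldt_coprime6 q / q * (1 / (x + ln q)\<^sup>2)))"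
  proof (rule sum_le_included[where i = "\<lambda>q. n * q"])
    show "\<forall>m\<in>A. \<exists>q\<in>{1..M}. n * q = m \<and> w m * (mangoldt (m div n) / ln m) \<le>
        1 / n * (mangoldt_coprime6 q / q * (1 / (x + ln q)\<^sup>2))"
    proof
      fix m assume m: "m \<in> A"
      then obtain q where q: "m = n * q" by (auto simp: A_def)
      have m': "m \<in> nat_over Q" "m > 1" "m \<le> M" using m X1 by (auto simp: A_def Y_def X_def)
      have "q > 0" using m' q by (auto intro: Nat.gr0I)
      have "q \<le> m" using q \<open>n > 1\<close> by simp
      hence "q \<le> M" using m' by simp
      have "coprime q 6"
        using coprime6_if_nat_over[of q Q] nat_over_dvd[OF m'(1), of q] q Q by simp
      moreover have "ln (real m) = x + ln (real q)"
        using q \<open>n > 1\<close> \<open>q > 0\<close> by (simp add: x_def ln_mult)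
      ultimately have "w m * (mangoldt (m div n) / ln m) =
          1 / n * (mangoldt_coprime6 q / q * (1 / (x + ln q)\<^sup>2))"
        using q \<open>n > 1\<close> by (simp add: w_def mangoldt_coprime6_def power2_eq_square)
      thus "\<exists>q\<in>{1..M}. n * q = m \<and> w m * (mangoldt (m div n) / ln m) \<le>
          1 / n * (mangoldt_coprime6 q / q * (1 / (x + ln q)\<^sup>2))"
        using q \<open>q > 0\<close> \<open>q \<le> M\<close> by (intro bexI[of _ q]) auto
    qed
  qed (use \<open>finite Y\<close> mangoldt_coprime6_nonneg in \<open>auto simp: A_def\<close>)
  also have "\<dots> = 1 / n * (\<Sum>q = 1..M. mangoldt_coprime6 q / q * (1 / (x + ln q)\<^sup>2))"
    by (simp only: sum_distrib_left)
  also have "\<dots> \<le> 1 / n * ((x + 2 * ln 5) / (x + ln 5)\<^sup>2)"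
    by (intro mult_left_mono sum_mangoldt_coprime6_kernel_le \<open>x > 0\<close>) auto
  also have "(\<Sum>m\<in>B. w m) \<le> (\<Sum>k = 2..M. 1 / (2 * x) * (1 / n) ^ k)"
  proof (rule sum_le_included[where i = "\<lambda>k. n ^ k"])
    show "\<forall>m\<in>B. \<exists>k\<in>{2..M}. n ^ k = m \<and> w m \<le> 1 / (2 * x) * (1 / n) ^ k"
    proof
      fix m assume "m \<in> B"
      then obtain k where k: "k \<ge> 2" "m = n ^ k" "m \<le> M" by (auto simp: B_def Y_def)
      have "k \<le> M" using less_exp[of k] power_mono[of 2 n k] k \<open>n > 1\<close> by linarith
      have "w m = 1 / (real n ^ k * (real k * x))"
        using k \<open>n > 1\<close> by (simp add: w_def x_def ln_realpow)
      also have "\<dots> \<le> 1 / (real n ^ k * (2 * x))"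
        using k \<open>n > 1\<close> \<open>x > 0\<close> by (intro divide_left_mono mult_left_mono mult_right_mono mult_pos_pos) auto
      also have "\<dots> = 1 / (2 * x) * (1 / n) ^ k"
        by (simp add: power_one_over field_simps)
      finally show "\<exists>k\<in>{2..M}. n ^ k = m \<and> w m \<le> 1 / (2 * x) * (1 / n) ^ k"
        using k \<open>k \<le> M\<close> by (intro bexI[of _ k]) auto
    qed
  qed (use \<open>finite Y\<close> \<open>x > 0\<close> in \<open>auto simp: B_def\<close>)
  also have "\<dots> = 1 / (2 * x) * (\<Sum>k = 2..M. (1 / n) ^ k)"
    by (simp only: sum_distrib_left)
  also have "\<dots> \<le> 1 / (2 * x) * ((1 / n)\<^sup>2 / (1 - 1 / n))"
    using \<open>n > 1\<close> \<open>x > 0\<close> by (intro mult_left_mono geometric_tail_le) auto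
  also have "\<dots> = 1 / n * (1 / (2 * x * (real n - 1)))"
    using \<open>n > 1\<close> \<open>x > 0\<close> by (simp add: field_simps power2_eq_square)
  also have "1 / n * ((x + 2 * ln 5) / (x + ln 5)\<^sup>2) + 1 / n * (1 / (2 * x * (real n - 1))) =
      1 / n * ((x + 2 * ln 5) / (x + ln 5)\<^sup>2 + 1 / (2 * x * (real n - 1)))"
    by (simp only: distrib_left)
  also have "\<dots> \<le> 1 / n * (1 / x)"
    using primepow_inflow_slack[of n] \<open>n \<ge> 5\<close> unfolding x_def by (intro mult_left_mono) auto
  also have "\<dots> = w n" by (simp add: w_def x_def)
  finally show ?thesis by (simp add: Y_def)
qed

text \<open>A sum in \<open>ennreal\<close> is the supremum of its finite partial sums, and a finite part of a primitive
  set is an antichain to which the flow argument applies.\<close>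

theorem erdos_best_primes_gt3:
  assumes Q: "\<And>q. q \<in> Q \<Longrightarrow> prime q \<and> q > 3"
  shows "erdos_best Q"
  unfolding erdos_best_def
proof (intro allI impI)
  fix S assume S: "S \<subseteq> nat_over Q \<and> primitive_set S"
  define w where "w = (\<lambda>n :: nat. 1 / (real n * ln (real n)))"
  have w_nonneg: "w n \<ge> 0" for n by (cases "n = 0") (auto simp: w_def)
  define X where "X = nat_over Q - {1}"
  have "1 \<notin> S"
  proof
    assume "1 \<in> S"
    moreover obtain m where "m \<in> S" "m \<noteq> 1"
      using S \<open>1 \<in> S\<close> by (auto simp: primitive_set_def)
    ultimately show False using S by (auto simp: primitive_set_def)
  qed
  hence SX: "S \<subseteq> X" using S by (auto simp: X_def)
  interpret divisor_chain mangoldt_descent X Q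
    unfolding X_def using Q by (intro divisor_chain_mangoldt_descent) auto
  have QX: "Q \<subseteq> X"
  proof
    fix q assume "q \<in> Q"
    hence "prime q" using Q by blast
    thus "q \<in> X" using \<open>q \<in> Q\<close> primes_dvd_imp_eq[of _ q]
      by (auto simp: X_def nat_over_def prime_gt_0_nat)
  qed
  have "(\<Sum>n\<in>F. ennreal (w n)) \<le> erdos_sum Q" if F: "finite F" "F \<subseteq> S" for F
  proof -
    obtain M where M: "F \<subseteq> {..M}" using F(1) finite_nat_iff_bounded_le by blast
    have "sum w F \<le> sum w (Q \<inter> {..M})"
    proof (rule sum_antichain_le [OF QX])
      show "(\<Sum>m\<in>X \<inter> {..M}. w m * mangoldt_descent m n) \<le> w n" if "n \<in> X" for n
        using erdos_weight_superharmonic[of Q n M] Q that by (simp add: X_def w_def)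
      show "F \<subseteq> X \<inter> {..M}" using F M SX by auto
      show "a = b" if "a \<in> F" "b \<in> F" "a dvd b" for a b
        using S F that by (auto simp: primitive_set_def)
    qed
    hence "(\<Sum>n\<in>F. ennreal (w n)) \<le> (\<Sum>n\<in>Q \<inter> {..M}. ennreal (w n))"
      by (simp add: sum_ennreal w_nonneg ennreal_leI)
    also have "\<dots> \<le> (\<Sum>\<^sub>\<infinity>n\<in>Q. ennreal (w n))"
    proof -
      have "(\<Sum>\<^sub>\<infinity>n\<in>Q \<inter> {..M}. ennreal (w n)) \<le> (\<Sum>\<^sub>\<infinity>n\<in>Q. ennreal (w n))"
        by (intro infsum_mono_neutral nonneg_summable_on_complete) auto
      thus ?thesis by simp
    qed
    finally show ?thesis by (simp add: erdos_sum_def w_def)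
  qed
  thus "erdos_sum S \<le> erdos_sum Q"
    unfolding erdos_sum_def[of S] w_def
    by (intro infsum_le_finite_sums nonneg_summable_on_complete) auto
qed

theorem corollary4:
  shows "erdos_best twin_primes_gt3"
  by (rule erdos_best_primes_gt3) (simp add: twin_primes_gt3_def)

end
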